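(* Let $X$ be a dendrite. Then a generic continuous map $f\colon X\to X$ is almost chain continuous; that is, the set of almost chain continuous maps contains a countable intersection of open dense subsets of the space of all continuous maps $X\to X$ with the topology of uniform convergence.
   Context: A dendrite is a compact metric space $X$ (with metric $d$) that is connected, locally connected, and contains no simple closed curves (no subset homeomorphic to the circle). The space of continuous self-maps of $X$ carries the topology induced by the metric $\sup_{x\in X}d(f(x),g(x))$. For a continuous map $f\colon X\to X$ and $\delta>0$, a sequence $(x_i)_{i\ge0}$ in $X$ is a $\delta$-pseudo orbit of $f$ if $d(f(x_i),x_{i+1})\le\delta$ for all $i\ge0$; for $\epsilon>0$, it is $\epsilon$-shadowed by $x\in X$ if $d(f^i(x),x_i)\le\epsilon$ for all $i\ge0$. The map $f$ is chain continuous at $x\in X$ if for every $\epsilon>0$ there is $\delta>0$ such that every $\delta$-pseudo orbit $(x_i)_{i\ge0}$ of $f$ with $x_0=x$ is $\epsilon$-shadowed by $x$. $CC(f)$ denotes the set of points at which $f$ is chain continuous, and $f$ is almost chain continuous if $CC(f)$ is a dense $G_\delta$-subset of $X$. *)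

theory Defs
  imports "HOL-Analysis.Analysis"
begin

definition dendrite :: "'a::metric_space set \<Rightarrow> bool" where
  "dendrite X \<longleftrightarrow> compact X \<and> connected X \<and> locally connected X \<and>
     \<not> (\<exists>C\<subseteq>X. C homeomorphic sphere (0::complex) 1)"

definition pseudo_orbit :: "('a::metric_space \<Rightarrow> 'a) \<Rightarrow> real \<Rightarrow> (nat \<Rightarrow> 'a) \<Rightarrow> bool" where
  "pseudo_orbit f \<delta> x \<longleftrightarrow> (\<forall>i. dist (f (x i)) (x (Suc i)) \<le> \<delta>)"

definition shadowed_by :: "('a::metric_space \<Rightarrow> 'a) \<Rightarrow> real \<Rightarrow> (nat \<Rightarrow> 'a) \<Rightarrow> 'a \<Rightarrow> bool" where
  "shadowed_by f \<epsilon> x p \<longleftrightarrow> (\<forall>i. dist ((f ^^ i) p) (x i) \<le> \<epsilon>)"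

definition chain_continuous_at :: "('a::metric_space \<Rightarrow> 'a) \<Rightarrow> 'a \<Rightarrow> bool" where
  "chain_continuous_at f p \<longleftrightarrow>
     (\<forall>\<epsilon>>0. \<exists>\<delta>>0. \<forall>x. pseudo_orbit f \<delta> x \<and> x 0 = p \<longrightarrow> shadowed_by f \<epsilon> x p)"

definition CC :: "('a::metric_space \<Rightarrow> 'a) \<Rightarrow> 'a set" where
  "CC f = {p. chain_continuous_at f p}"

definition almost_chain_continuous :: "('a::metric_space \<Rightarrow> 'a) \<Rightarrow> bool" where
  "almost_chain_continuous f \<longleftrightarrow> closure (CC f) = UNIV \<and> gdelta_in euclidean (CC f)"

text \<open>The space of continuous self-maps of a compact space, with the topology of uniform
  convergence, is the library type of bounded continuous functions, whose metric is
  the supremum distance: on a compact space every continuous map is bounded.\<close>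

lemma bcontfun_eq_continuous_if_compact:
  assumes "compact (UNIV :: 'a::metric_space set)"
  shows "(bcontfun :: ('a \<Rightarrow> 'a) set) = {f. continuous_on UNIV f}"
  using assms by (auto simp: bcontfun_def intro: compact_imp_bounded compact_continuous_image)

end

theory Submission
  imports Defs
begin

text \<open>Two properties of a dendrite are used: small path connected neighbourhoods, and small
  neighbourhoods with finite frontier. The former is the classical fact that complete, locally connected
  metric spaces are locally path connected. The latter comes from the absence of circles: an
  interior point of an arc between two points separates them
  (\<open>exists_separating_point\<close>), and compactness turns the components
  cut off by single points into a neighbourhood basis with finite frontiers
  (\<open>finite_frontier_neighbourhood\<close>).

  Let \<open>f\<close> be a continuous self-map. On a neighbourhood of a point with finite frontier, \<open>f\<close> can be
  redefined so that it is constant near the point: only finitely many boundary values must be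
  kept, and they are reached along paths that stay in a small path connected set. In this way \<open>f\<close> is
  approximated by a map \<open>g\<close> with a finite, \<open>\<epsilon>\<close>-dense set \<open>P\<close> such that near each point of \<open>P\<close> the map
  \<open>g\<close> is constant with value in \<open>P\<close> (\<open>approximate_by_locally_constant_at_finite_set\<close>).
  Small balls around the points of \<open>P\<close> are then mapped to centres of such balls, so for every map
  near \<open>g\<close> all pseudo orbits that start in one of them with small errors stay together
  (\<open>trap_stable_points\<close>). Hence the maps whose points of stability up to \<open>\<epsilon>\<close> are
  \<open>\<epsilon>\<close>-dense contain an open dense set of maps. For a map in the intersection over
  \<open>\<epsilon> = 1 / (n+1)\<close>, the points of chain continuity form a countable intersection of dense open sets
  (\<open>CC_eq_Inter_stable_points\<close>), and Baire's theorem applies.\<close>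

section \<open>Local path connectedness\<close>

text \<open>The inclusion is required around both points so that the relation is symmetric, and chainability
inside a connected set becomes an equivalence relation.\<close>

definition linked :: "real \<Rightarrow> 'a::metric_space \<Rightarrow> 'a \<Rightarrow> bool" where
  "linked \<epsilon> x y \<longleftrightarrow> (\<exists>C. connected C \<and> x \<in> C \<and> y \<in> C \<and> C \<subseteq> ball x \<epsilon> \<and> C \<subseteq> ball y \<epsilon>)"

lemma linked_refl: "0 < \<epsilon> \<Longrightarrow> linked \<epsilon> x x"
  unfolding linked_def by (rule exI[of _ "{x}"]) simp

lemma linked_sym: "linked \<epsilon> x y \<Longrightarrow> linked \<epsilon> y x"
  unfolding linked_def by blast

lemma linked_imp_dist: "linked \<epsilon> x y \<Longrightarrow> dist x y < \<epsilon>"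
  unfolding linked_def by (metis mem_ball subsetD)

lemma locally_connected_UNIV_ball:
  fixes x :: "'a::metric_space"
  assumes "locally connected (UNIV :: 'a set)" "0 < \<epsilon>"
  obtains D where "open D" "connected D" "x \<in> D" "D \<subseteq> ball x \<epsilon>"
  using assms(1)[unfolded locally_connected, rule_format, of "ball x \<epsilon>" x] assms(2)
  by auto

text \<open>Chainability by links of a fixed size is an equivalence relation on a connected set, and local
connectedness makes its classes open, so there is only one class. The chain is a sequence that is
constant from some index on, so that chains of different lengths can be cut to a common length.\<close>

lemma connected_imp_chain:
  fixes C :: "'a::metric_space set"
  assumes lc: "locally connected (UNIV :: 'a set)" and "connected C" "x \<in> C" "y \<in> C" "0 < \<epsilon>"
  obtains z :: "nat \<Rightarrow> 'a" and L where "z 0 = x" "\<And>i. i \<ge> L \<Longrightarrow> z i = y" "\<And>i. z i \<in> C"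
    "\<And>i. linked \<epsilon> (z i) (z (Suc i))"
proof -
  let ?S = "\<lambda>u v. linked \<epsilon> u v \<and> u \<in> C \<and> v \<in> C"
  have "?S\<^sup>*\<^sup>* x y"
  proof (rule connected_equivalence_relation[OF \<open>connected C\<close> \<open>x \<in> C\<close> \<open>y \<in> C\<close>])
    fix u v assume "?S\<^sup>*\<^sup>* u v"
    moreover have "symp ?S" by (auto intro!: sympI intro: linked_sym)
    ultimately show "?S\<^sup>*\<^sup>* v u" by (rule sympD[OF symp_rtranclp, rotated])
  next
    fix u assume u: "u \<in> C"
    obtain D where D: "open D" "connected D" "u \<in> D" "D \<subseteq> ball u (\<epsilon>/2)"
      by (rule locally_connected_UNIV_ball[OF lc, of "\<epsilon>/2" u]) (use \<open>0 < \<epsilon>\<close> in auto)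
    have "linked \<epsilon> u v" if "v \<in> D" for v
      unfolding linked_def
    proof (intro exI conjI)
      show "D \<subseteq> ball u \<epsilon>" using D(4) \<open>0 < \<epsilon>\<close> by (auto simp: subset_iff)
      show "D \<subseteq> ball v \<epsilon>"
      proof
        fix w assume "w \<in> D"
        then have "dist u w < \<epsilon>/2" "dist u v < \<epsilon>/2" using D(4) that by auto
        then show "w \<in> ball v \<epsilon>" using dist_triangle_half_r[of u v \<epsilon> w] by (auto simp: dist_commute)
      qed
    qed (use D that in auto)
    then show "\<exists>T. openin (top_of_set C) T \<and> u \<in> T \<and> (\<forall>v\<in>T. ?S\<^sup>*\<^sup>* u v)"
      using D u by (intro exI[of _ "C \<inter> D"]) (auto intro!: r_into_rtranclp)
  qed auto
  from rtranclp_imp_relpowp[OF this] obtain n where "(?S ^^ n) x y" by (elim exE)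
  then have "\<exists>w. w 0 = x \<and> w n = y \<and> (\<forall>i<n. ?S (w i) (w (Suc i)))"
    by (simp only: relpowp_fun_conv)
  then obtain w where w: "w 0 = x" "w n = y" "\<And>i. i < n \<Longrightarrow> ?S (w i) (w (Suc i))"
    by (elim exE conjE) simp
  let ?z = "\<lambda>i. if i < n then w i else y"
  show thesis
  proof (rule that[of ?z n])
    show "?z 0 = x" using w by auto
    show "?z i \<in> C" for i using w \<open>y \<in> C\<close> by auto
    show "linked \<epsilon> (?z i) (?z (Suc i))" for i
      using w(3)[of i] w(2) linked_refl[OF \<open>0 < \<epsilon>\<close>, of y] by (cases "Suc i = n") auto
  qed auto
qed

text \<open>The pair \<open>(M, x)\<close> stands for the step function on \<open>[0,1]\<close> that takes the value \<open>x k\<close> on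
\<open>[k/M, (k+1)/M)\<close>.\<close>

definition grid_chain :: "'a::metric_space \<Rightarrow> 'a \<Rightarrow> real \<Rightarrow> nat \<times> (nat \<Rightarrow> 'a) \<Rightarrow> bool" where
  "grid_chain a b \<epsilon> c \<longleftrightarrow> 0 < fst c \<and> snd c 0 = a \<and> (\<forall>i\<ge>fst c. snd c i = b) \<and>
     (\<forall>i. linked \<epsilon> (snd c i) (snd c (Suc i)))"

text \<open>Every link of the chain is replaced by a finer chain inside its small connected set. The
replacements are all given the same length \<open>N\<close>, so that the new step function again lives on a
uniform grid and stays within \<open>\<epsilon>\<close> of the old one.\<close>

lemma grid_chain_refine:
  fixes a b :: "'a::metric_space"
  assumes lc: "locally connected (UNIV :: 'a set)" and "grid_chain a b \<epsilon> (M, x)" "0 < \<epsilon>'" "0 < \<epsilon>"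
  obtains N y where "0 < N" "grid_chain a b \<epsilon>' (M * N, y)"
    "\<And>k j. j \<le> N \<Longrightarrow> dist (y (k * N + j)) (x k) < \<epsilon>"
proof -
  from assms(2) have M: "0 < M" "x 0 = a" "\<And>i. i \<ge> M \<Longrightarrow> x i = b" "\<And>i. linked \<epsilon> (x i) (x (Suc i))"
    unfolding grid_chain_def by auto
  have "\<exists>z L. z 0 = x k \<and> (\<forall>i\<ge>L. z i = x (Suc k)) \<and> (\<forall>i. dist (z i) (x k) < \<epsilon>) \<and>
     (\<forall>i. linked \<epsilon>' (z i) (z (Suc i)))" for k
  proof -
    obtain C where C': "connected C" "x k \<in> C" "x (Suc k) \<in> C" and C: "C \<subseteq> ball (x k) \<epsilon>"
      using M(4)[of k] unfolding linked_def by auto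
    obtain z L where zL: "z 0 = x k" "\<And>i. i \<ge> L \<Longrightarrow> z i = x (Suc k)" "\<And>i. z i \<in> C"
      "\<And>i. linked \<epsilon>' (z i) (z (Suc i))"
      by (rule connected_imp_chain[OF lc C' \<open>0 < \<epsilon>'\<close>]) blast
    have "dist (z i) (x k) < \<epsilon>" for i
      using zL(3)[of i] C by (auto simp: dist_commute)
    then show ?thesis using zL by (intro exI[of _ z] exI[of _ L]) auto
  qed
  then obtain z L where z: "\<And>k. z k 0 = x k" "\<And>k i. i \<ge> L k \<Longrightarrow> z k i = x (Suc k)"
    "\<And>k i. dist (z k i) (x k) < \<epsilon>" "\<And>k i. linked \<epsilon>' (z k i) (z k (Suc i))"
    by metis
  define N where "N = Suc (\<Sum>k<M. L k)"
  have N0: "0 < N" by (simp add: N_def)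
  have N: "L k \<le> N" if "k < M" for k
    using that member_le_sum[of k "{..<M}" L] by (auto simp: N_def)
  define y where "y i = (if i div N < M then z (i div N) (i mod N) else b)" for i
  have yb: "y i = b" if "M * N \<le> i" for i
    using that by (auto simp: y_def N_def less_mult_imp_div_less less_eq_div_iff_mult_less_eq leD)
  have yk: "y (k * N + j) = (if k < M then z k j else b)" if "j \<le> N" for k j
  proof (cases "j = N")
    case False
    then have "j < N" using that by simp
    then show ?thesis by (simp add: y_def)
  next
    case True
    then have "k * N + j = Suc k * N" by simp
    then have "y (k * N + j) = (if Suc k < M then x (Suc k) else b)"
      using z(1) N0 by (simp add: y_def del: mult_Suc)
    then show ?thesis using True z(2)[of k N] M(3)[of "Suc k"] N[of k] by auto
  qed
  have "linked \<epsilon>' (y i) (y (Suc i))" for i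
  proof -
    define k j where "k = i div N" and "j = i mod N"
    have "i = k * N + j" "j < N" using N0 by (auto simp: k_def j_def)
    then have "y i = (if k < M then z k j else b)" "y (Suc i) = (if k < M then z k (Suc j) else b)"
      using yk[of j k] yk[of "Suc j" k] by auto
    then show ?thesis using z(4) linked_refl[OF \<open>0 < \<epsilon>'\<close>] by auto
  qed
  moreover have "y 0 = a" using z(1) M by (auto simp: y_def)
  ultimately have "grid_chain a b \<epsilon>' (M * N, y)"
    using yb M N_def by (auto simp: grid_chain_def)
  moreover have "dist (y (k * N + j)) (x k) < \<epsilon>" if "j \<le> N" for k j
    using yk[OF that, of k] z(3)[of k j] M(3)[of k] \<open>0 < \<epsilon>\<close> by auto
  ultimately show thesis using that N_def by blast
qed

text \<open>The path is the uniform limit of step functions whose jumps and successive distances are bounded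
by \<open>\<epsilon> / 2 ^ n\<close>: the jump bound makes the limit continuous, and the summable distances keep it near the
first step function, which takes the values \<open>a\<close> and \<open>b\<close> only.\<close>

lemma linked_imp_path:
  fixes a b :: "'a::metric_space"
  assumes lc: "locally connected (UNIV :: 'a set)" and comp: "complete (UNIV :: 'a set)" 
    and "linked \<epsilon> a b" "0 < \<epsilon>"
  obtains p where "path p" "pathstart p = a" "pathfinish p = b" "path_image p \<subseteq> ball a (4 * \<epsilon>)"
proof -
  define E where "E n = \<epsilon> / 2 ^ n" for n :: nat
  have E: "0 < E n" "E (Suc n) = E n / 2" "E 0 = \<epsilon>" for n using \<open>0 < \<epsilon>\<close> by (auto simp: E_def)
  have Elim: "E \<longlonglongrightarrow> 0" unfolding E_def
    using tendsto_mult[OF tendsto_const[of \<epsilon>] LIMSEQ_inverse_realpow_zero[of 2]] by (simp add: divide_inverse)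
  let ?ref = "\<lambda>n c c'. \<exists>N>0. fst c' = fst c * N \<and> (\<forall>k j. j \<le> N \<longrightarrow> dist (snd c' (k * N + j)) (snd c k) < E n)"
  define c0 where "c0 = (1::nat, \<lambda>i. if i = (0::nat) then a else b)"
  have c0: "grid_chain a b (E 0) c0"
    using \<open>linked \<epsilon> a b\<close> linked_refl[OF \<open>0 < \<epsilon>\<close>] by (auto simp: grid_chain_def E c0_def)
  have step: "\<exists>c'. grid_chain a b (E (Suc n)) c' \<and> ?ref n c c'" if *: "grid_chain a b (E n) c" for c n
  proof -
    obtain M x where c: "c = (M, x)" by force
    obtain N y where "0 < N" "grid_chain a b (E (Suc n)) (M * N, y)"
      "\<And>k j. j \<le> N \<Longrightarrow> dist (y (k * N + j)) (x k) < E n"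
      using grid_chain_refine[OF lc *[unfolded c] E(1)[of "Suc n"] E(1)[of n]] by blast
    then show ?thesis by (intro exI[of _ "(M * N, y)"]) (auto simp: c)
  qed
  obtain c where c: "c 0 = c0" "\<And>n. grid_chain a b (E n) (c n)" "\<And>n. ?ref n (c n) (c (Suc n))"
    using dependent_nat_choice[of "\<lambda>n c. grid_chain a b (E n) c \<and> (n = 0 \<longrightarrow> c = c0)" ?ref] c0 step
    by (metis nat.discI)
  define P where "P n t = snd (c n) (nat \<lfloor>real (fst (c n)) * t\<rfloor>)" for n t
  have P0: "P n 0 = a" for n using c(2)[of n] by (auto simp: P_def grid_chain_def)
  have P1: "P n 1 = b" for n using c(2)[of n] by (auto simp: P_def grid_chain_def)
  have Pstep: "dist (P (Suc n) t) (P n t) < E n" if "0 \<le> t" for n t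
  proof -
    obtain N where N: "N > 0" "fst (c (Suc n)) = fst (c n) * N"
      "\<And>k j. j \<le> N \<Longrightarrow> dist (snd (c (Suc n)) (k * N + j)) (snd (c n) k) < E n" using c(3)[of n] by blast
    define k where "k = nat \<lfloor>real (fst (c n)) * t\<rfloor>"
    define m where "m = nat \<lfloor>real (fst (c (Suc n))) * t\<rfloor>"
    have "real k \<le> real (fst (c n)) * t" "real (fst (c n)) * t < real k + 1"
      using that by (auto simp: k_def)
    then have "real N * real k \<le> real N * (real (fst (c n)) * t)" "real N * (real (fst (c n)) * t) < real N * (real k + 1)"
      using N(1) by (auto intro: mult_left_mono mult_strict_left_mono)
    moreover have "real m \<le> real (fst (c (Suc n))) * t" "real (fst (c (Suc n))) * t < real m + 1"
      using that by (auto simp: m_def)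
    ultimately have "real N * real k < real m + 1" "real m < real N * (real k + 1)"
      unfolding N(2) by (auto simp: algebra_simps)
    \<comment> \<open>The cell of the fine grid that contains \<open>t\<close> lies in the cell of the coarse grid that contains \<open>t\<close>.\<close>
    then have "real (N * k) < real (m + 1)" "real m < real (N * (k + 1))" by (auto simp: algebra_simps)
    then have "N * k < m + 1" "m < N * (k + 1)" by (simp_all only: of_nat_less_iff)
    then have "m = k * N + (m - k * N)" "m - k * N \<le> N" by (auto simp: algebra_simps)
    then show ?thesis using N(3)[of "m - k * N" k] unfolding P_def k_def[symmetric] m_def[symmetric] by simp
  qed
  have Pdist: "dist (P (n + k) t) (P n t) \<le> 2 * E n - 2 * E (n + k)" if "0 \<le> t" for n k t
  proof (induction k)
    case (Suc k)
    have "dist (P (n + Suc k) t) (P n t) \<le> dist (P (Suc (n + k)) t) (P (n + k) t) + dist (P (n + k) t) (P n t)"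
      by (metis add_Suc_right dist_triangle)
    also have "\<dots> \<le> E (n + k) + (2 * E n - 2 * E (n + k))" using Pstep[OF that, of "n+k"] Suc by simp
    finally show ?case by (simp add: E(2))
  qed auto
  have Pd: "dist (P m t) (P n t) < 2 * E n" if "0 \<le> t" "m \<ge> n" for n m t
    using Pdist[OF that(1), of n "m - n"] that(2) E(1)[of m] by auto
  have "\<exists>l. (\<lambda>n. P n t) \<longlonglongrightarrow> l" if "0 \<le> t" for t
  proof -
    have "Cauchy (\<lambda>n. P n t)"
      unfolding Cauchy_altdef2
    proof (intro allI impI)
      fix e :: real assume "0 < e"
      then obtain n where "E n < e/2" 
        using Elim[THEN LIMSEQ_D, of "e/2"] E(1) by (metis abs_of_pos half_gt_zero diff_zero order_refl real_norm_def)
      then show "\<exists>N. \<forall>n\<ge>N. dist (P n t) (P N t) < e" using Pd[OF that] by (intro exI[of _ n]) (force)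
    qed
    then show ?thesis using comp unfolding complete_def by auto
  qed
  then obtain p where p: "\<And>t. 0 \<le> t \<Longrightarrow> (\<lambda>n. P n t) \<longlonglongrightarrow> p t" by metis
  have pP: "dist (P n t) (p t) \<le> 2 * E n" if "0 \<le> t" for t n
  proof (rule Lim_dist_ubound[of sequentially "\<lambda>m. P m t"])
    show "\<forall>\<^sub>F m in sequentially. dist (P n t) (P m t) \<le> 2 * E n"
      using Pd[OF that, of n] unfolding eventually_sequentially by (metis dist_commute less_imp_le)
  qed (use p[OF that] in simp_all)
  have "path p"
    unfolding path_def continuous_on_iff
  proof (intro ballI allI impI)
    fix t e :: real assume t: "t \<in> {0..1}" and "0 < e"
    then obtain n where n: "E n < e/5" 
      using Elim[THEN LIMSEQ_D, of "e/5"] E(1) 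
      by (metis abs_of_pos diff_zero order_refl real_norm_def zero_less_divide_iff zero_less_numeral)
    let ?M = "real (fst (c n))"
    have M: "?M > 0" using c(2)[of n] by (auto simp: grid_chain_def)
    have "dist (p s) (p t) < e" if "s \<in> {0..1}" "dist s t < 1 / ?M" for s
    proof -
      define k l where "k = nat \<lfloor>?M * s\<rfloor>" and "l = nat \<lfloor>?M * t\<rfloor>"
      have "\<bar>?M * s - ?M * t\<bar> = ?M * \<bar>s - t\<bar>"
        by (simp add: abs_mult flip: right_diff_distrib)
      also have "\<dots> < 1"
        using that(2) M by (simp add: dist_real_def field_simps)
      finally have "\<bar>?M * s - ?M * t\<bar> < 1" .
      moreover have "real k \<le> ?M * s" "?M * s < real k + 1" "real l \<le> ?M * t" "?M * t < real l + 1"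
        using t that(1) by (auto simp: k_def l_def)
      ultimately have "real k < real l + 2" "real l < real k + 2" by linarith+
      then have kl: "k = l \<or> k = Suc l \<or> l = Suc k" by linarith
      have lnk: "linked (E n) (snd (c n) i) (snd (c n) (Suc i))" for i
        using c(2)[of n] by (simp add: grid_chain_def)
      note link = linked_imp_dist[OF lnk] linked_imp_dist[OF linked_sym[OF lnk]]
      have "dist (snd (c n) k) (snd (c n) l) < E n"
        using kl link[of k] link[of l] E(1)[of n] by (elim disjE) simp_all
      then have "dist (P n s) (P n t) < E n"
        by (simp add: P_def k_def l_def)
      moreover have "dist (p s) (p t) \<le> dist (p s) (P n s) + dist (P n s) (P n t) + dist (P n t) (p t)"
        using dist_triangle[of "p s" "p t" "P n s"] dist_triangle[of "P n s" "p t" "P n t"] by linarith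
      moreover have "dist (p s) (P n s) \<le> 2 * E n" "dist (P n t) (p t) \<le> 2 * E n"
        using pP[of s n] pP[of t n] that t dist_commute[of "p s" "P n s"] by auto
      ultimately show ?thesis using n by linarith
    qed
    then show "\<exists>d>0. \<forall>s\<in>{0..1}. dist s t < d \<longrightarrow> dist (p s) (p t) < e"
      using M by (intro exI[of _ "1 / ?M"]) auto
  qed
  moreover have "p 0 = a" "p 1 = b" using p[of 0] p[of 1] P0 P1 by (auto simp: LIMSEQ_const_iff)
  moreover have "path_image p \<subseteq> ball a (4 * \<epsilon>)"
  proof 
    fix x assume "x \<in> path_image p"
    then obtain t where t: "0 \<le> t" "x = p t" by (auto simp: path_image_def)
    have "P 0 t \<in> {a, b}" by (auto simp: P_def c(1) c0_def)
    then have "dist a (P 0 t) < \<epsilon>" using linked_imp_dist[OF \<open>linked \<epsilon> a b\<close>] \<open>0 < \<epsilon>\<close> by auto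
    then show "x \<in> ball a (4 * \<epsilon>)"
      using pP[OF t(1), of 0] t(2) E(3) dist_triangle[of a x "P 0 t"] \<open>0 < \<epsilon>\<close> by auto
  qed
  ultimately show thesis using that by (auto simp: pathstart_def pathfinish_def)
qed

lemma complete_locally_connected_imp_locally_path_connected:
  assumes lc: "locally connected (UNIV :: 'a::metric_space set)" and comp: "complete (UNIV :: 'a set)" 
  shows "locally path_connected (UNIV :: 'a set)"
  unfolding locally_path_connected_im_kleinen
proof (intro allI impI, elim conjE)
  fix V and x :: 'a assume "openin (top_of_set UNIV) V" "x \<in> V"
  then have "open V" by simp
  then obtain e where e: "0 < e" "ball x e \<subseteq> V" using \<open>x \<in> V\<close> by (rule openE)
  obtain D where D: "open D" "connected D" "x \<in> D" "D \<subseteq> ball x (e/8)"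
    by (rule locally_connected_UNIV_ball[OF lc, of "e/8" x]) (use e(1) in auto)
  have "linked (e/4) x y" if "y \<in> D" for y
    unfolding linked_def
  proof (intro exI conjI)
    show "D \<subseteq> ball x (e/4)" using D(4) e by (auto simp: subset_iff)
    show "D \<subseteq> ball y (e/4)"
    proof
      fix w assume "w \<in> D"
      then have "dist x w < (e/4)/2" "dist x y < (e/4)/2" using D(4) that by auto
      then show "w \<in> ball y (e/4)" using dist_triangle_half_r[of x y "e/4" w] by (auto simp: dist_commute)
    qed
  qed (use D that in auto)
  then have link: "linked (e/4) x y" if "y \<in> D" for y
    using that by blast
  have "\<exists>p. path p \<and> path_image p \<subseteq> V \<and> pathstart p = x \<and> pathfinish p = y" if "y \<in> D" for y
    by (rule linked_imp_path[OF lc comp link[OF that]]) (use e in auto)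
  then show "\<exists>U. openin (top_of_set UNIV) U \<and> x \<in> U \<and> U \<subseteq> V \<and>
           (\<forall>y. y \<in> U \<longrightarrow> (\<exists>p. path p \<and> path_image p \<subseteq> V \<and> pathstart p = x \<and> pathfinish p = y))"
  proof (intro exI conjI)
    have "ball x (e/8) \<subseteq> ball x e" using e by (intro subset_ball) auto
    then show "D \<subseteq> V" using D e by blast
  qed (use D in auto)
qed

section \<open>Neighbourhoods with finite frontier\<close>

text \<open>The Kuratowski embedding with base point \<open>w\<close>. It is an isometry into a Banach space and makes
results on arcs in Banach spaces available for an arbitrary metric space.\<close>

definition kuratowski :: "'a::metric_space \<Rightarrow> 'a \<Rightarrow> ('a \<Rightarrow>\<^sub>C real)" where
  "kuratowski w x = Bcontfun (\<lambda>y. dist x y - dist w y)"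

lemma apply_kuratowski: "apply_bcontfun (kuratowski w x) y = dist x y - dist w y"
proof -
  have "\<bar>dist x y - dist w y\<bar> \<le> dist x w" for y
    using dist_triangle[of x y w] dist_triangle2[of w y x] by (simp add: dist_commute abs_le_iff)
  then have "(\<lambda>y. dist x y - dist w y) \<in> bcontfun"
    by (intro bcontfun_normI[where b="dist x w"]) (auto intro!: continuous_intros)
  then show ?thesis by (simp add: kuratowski_def Bcontfun_inverse)
qed

lemma dist_kuratowski: "dist (kuratowski w x) (kuratowski w x') = dist x x'"
proof (rule antisym)
  show "dist (kuratowski w x) (kuratowski w x') \<le> dist x x'"
  proof (rule dist_bound)
    fix y
    have "\<bar>dist x y - dist x' y\<bar> \<le> dist x x'"
      using dist_triangle[of x y x'] dist_triangle2[of x' y x] by (simp add: dist_commute abs_le_iff)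
    then show "dist (apply_bcontfun (kuratowski w x) y) (apply_bcontfun (kuratowski w x') y) \<le> dist x x'"
      by (simp add: apply_kuratowski dist_real_def)
  qed
  show "dist x x' \<le> dist (kuratowski w x) (kuratowski w x')"
    using dist_bounded[of "kuratowski w x" x' "kuratowski w x'"] by (simp add: apply_kuratowski dist_real_def)
qed

text \<open>Around \<open>c\<close> the arc \<open>g\<close> leaves the arc \<open>h\<close>; the maximal piece of \<open>g\<close> around \<open>c\<close> that meets \<open>h\<close> only in
its two end points is closed up by the piece of \<open>h\<close> between these points.\<close>

lemma circle_in_two_arcs:
  fixes g h :: "real \<Rightarrow> 'a::real_normed_vector"
  assumes "arc g" "arc h" and start: "pathstart g = pathstart h" and finish: "pathfinish g = pathfinish h"
    and c: "c \<in> path_image g" "c \<notin> path_image h"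
  obtains C where "C \<subseteq> path_image g \<union> path_image h" "C homeomorphic sphere (0::complex) 1"
proof -
  have contg: "continuous_on {0..1} g" and inj: "inj_on g {0..1}" using \<open>arc g\<close> by (auto simp: arc_def path_def)
  obtain t where t: "t \<in> {0..1}" "c = g t" using c by (auto simp: path_image_def)
  have H: "closed (path_image h)" using \<open>arc h\<close> by (rule closed_arc_image)
  have K: "compact ({a..b} \<inter> g -` path_image h)" if "{a..b} \<subseteq> {0..1}" for a b
    using continuous_on_closed_vimage[of "{a..b}" g] continuous_on_subset[OF contg that] H
    by (simp add: compact_eq_bounded_closed bounded_Int Int_commute[of "{a..b}"])
  \<comment> \<open>The maximal piece is \<open>[s, u]\<close>, where \<open>s\<close> and \<open>u\<close> are the last time before \<open>t\<close> and the first time after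
    \<open>t\<close> at which \<open>g\<close> is on \<open>h\<close>.\<close>
  have "0 \<in> {0..t} \<inter> g -` path_image h" "1 \<in> {t..1} \<inter> g -` path_image h"
    using t start finish pathstart_in_path_image[of h] pathfinish_in_path_image[of h]
    by (auto simp: pathstart_def pathfinish_def)
  then have "\<exists>s \<in> {0..t} \<inter> g -` path_image h. \<forall>r \<in> {0..t} \<inter> g -` path_image h. r \<le> s"
    "\<exists>u \<in> {t..1} \<inter> g -` path_image h. \<forall>r \<in> {t..1} \<inter> g -` path_image h. u \<le> r"
    using t by (intro compact_attains_sup compact_attains_inf K; force)+
  then obtain s u where s: "0 \<le> s" "s \<le> t" "g s \<in> path_image h" "\<And>r. \<lbrakk>0 \<le> r; r \<le> t; g r \<in> path_image h\<rbrakk> \<Longrightarrow> r \<le> s"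
    and u: "t \<le> u" "u \<le> 1" "g u \<in> path_image h" "\<And>r. \<lbrakk>t \<le> r; r \<le> 1; g r \<in> path_image h\<rbrakk> \<Longrightarrow> u \<le> r"
    by auto
  have "s \<noteq> t" "t \<noteq> u" using s u t c by auto
  then have su: "s < u" using s u by auto
  have ne: "g s \<noteq> g u" using inj_onD[OF inj, of s u] su s u by auto
  obtain a b where a: "a \<in> {0..1}" "g s = h a" and b: "b \<in> {0..1}" "g u = h b"
    using s(3) u(3) by (auto simp: path_image_def)
  have "a \<noteq> b" using ne a b by auto
  define \<gamma> where "\<gamma> = subpath s u g +++ subpath b a h"
  have sub: "path_image (subpath b a h) \<subseteq> path_image h" "path_image (subpath s u g) \<subseteq> path_image g"
    using path_image_subpath_subset[of b a h] path_image_subpath_subset[of s u g] a(1) b(1) s(1,2) u(1,2) by auto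
  have int: "path_image (subpath s u g) \<inter> path_image (subpath b a h) \<subseteq> {g s, g u}"
  proof 
    fix x assume "x \<in> path_image (subpath s u g) \<inter> path_image (subpath b a h)"
    then have "x \<in> g ` {s..u}" "x \<in> path_image h"
      using sub(1) su by (auto simp: path_image_subpath[of s u g])
    then obtain r where r: "s \<le> r" "r \<le> u" "x = g r" "g r \<in> path_image h" by auto
    then have "r = s \<or> r = u" using s(1) s(4)[of r] u(2) u(4)[of r] by linarith
    then show "x \<in> {g s, g u}" using r by auto
  qed
  have "simple_path \<gamma>" unfolding \<gamma>_def
  proof (rule simple_path_join_loop)
    show "arc (subpath s u g)" "arc (subpath b a h)"
      using arc_subpath_arc[OF \<open>arc g\<close>, of s u] arc_subpath_arc[OF \<open>arc h\<close>, of b a] su s u a b \<open>a \<noteq> b\<close> by auto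
  qed (use a b int in auto)
  moreover have "pathfinish \<gamma> = pathstart \<gamma>" using a by (simp add: \<gamma>_def)
  ultimately have "path_image \<gamma> homeomorphic sphere (0::complex) 1"
    by (intro homeomorphic_simple_path_image_circle) auto
  moreover have "path_image \<gamma> \<subseteq> path_image g \<union> path_image h"
    using path_image_join_subset[of "subpath s u g" "subpath b a h"] sub unfolding \<gamma>_def by blast
  ultimately show thesis using that by blast
qed

text \<open>Any point in the interior of an arc from \<open>q\<close> to \<open>z\<close> separates them: otherwise a second arc from \<open>q\<close> to
\<open>z\<close> would avoid it, and the two arcs would contain a circle. The arcs live in the image of the
Kuratowski embedding, and the circle is pulled back.\<close>

lemma exists_separating_point:
  fixes q z :: "'a::metric_space"
  assumes lpc: "locally path_connected (UNIV :: 'a set)" and conn: "connected (UNIV :: 'a set)"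
    and nocirc: "\<nexists>C :: 'a set. C homeomorphic sphere (0::complex) 1" and "q \<noteq> z"
  obtains c where "c \<noteq> q" "c \<noteq> z" "\<not> connected_component (- {c}) q z"
proof -
  define e where "e = kuratowski q"
  have dist_e: "dist (e x) (e y) = dist x y" for x y by (simp add: e_def dist_kuratowski)
  have inj: "inj e" by (metis injI dist_e dist_eq_0_iff)
  have conte: "continuous_on S e" for S using dist_e by (auto simp: continuous_on_iff)
  have conti: "continuous_on (range e) (inv e)" using dist_e inj by (auto simp: continuous_on_iff)
  have nocirc': False if C: "C \<subseteq> range e" "C homeomorphic sphere (0::complex) 1" for C
  proof -
    have "homeomorphism C (inv e ` C) (inv e) e"
      using C(1) conte continuous_on_subset[OF conti C(1)] inj
      by (auto simp: homeomorphism_def image_image f_inv_into_f subset_iff image_iff)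
    then have "inv e ` C homeomorphic C" using homeomorphic_def homeomorphic_sym by blast
    then show False using nocirc C(2) homeomorphic_trans by blast
  qed
  have arcs: "\<exists>g. arc g \<and> pathstart g = e q \<and> pathfinish g = e z \<and> path_image g \<subseteq> e ` S"
    if S: "path_component S q z" for S
  proof -
    obtain p where p: "path p" "path_image p \<subseteq> S" "pathstart p = q" "pathfinish p = z"
      using S unfolding path_component_def by blast
    have "path (e \<circ> p)" using p(1) conte by (rule path_continuous_image)
    moreover have "e q \<noteq> e z" using inj \<open>q \<noteq> z\<close> by (auto dest: injD)
    ultimately obtain g where "arc g" "path_image g \<subseteq> path_image (e \<circ> p)" "pathstart g = e q" "pathfinish g = e z"
      using path_contains_arc[of "e \<circ> p" "e q" "e z"] p by (auto simp: pathstart_compose pathfinish_compose)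
    then show ?thesis using p(2) unfolding path_image_compose by (intro exI[of _ g]) auto
  qed
  have "path_component UNIV q z"
    using path_component_eq_connected_component[OF lpc] conn
    by (simp add: connected_component_eq_UNIV connected_iff_connected_component)
  then obtain g where g: "arc g" "pathstart g = e q" "pathfinish g = e z" "path_image g \<subseteq> range e"
    using arcs by blast
  have "g (1/2) \<in> path_image g" by (auto simp: path_image_def)
  then obtain c where c: "g (1/2) = e c" using g by blast
  have "g (1/2) \<noteq> g 0" "g (1/2) \<noteq> g 1"
    using arc_imp_inj_on[OF g(1)] inj_onD[of g "{0..1}" "1/2" 0] inj_onD[of g "{0..1}" "1/2" 1] by auto
  then have ne: "c \<noteq> q" "c \<noteq> z" using c g by (auto simp: pathstart_def pathfinish_def)
  have "\<not> path_component (- {c}) q z"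
  proof
    assume "path_component (- {c}) q z"
    then obtain h where h: "arc h" "pathstart h = e q" "pathfinish h = e z" "path_image h \<subseteq> e ` (- {c})"
      using arcs by blast
    then have "e c \<notin> path_image h" using inj by (auto dest: injD)
    then obtain C where "C \<subseteq> path_image g \<union> path_image h" "C homeomorphic sphere (0::complex) 1"
      using circle_in_two_arcs[of g h "e c"] g h c \<open>g (1/2) \<in> path_image g\<close> by metis
    then show False using nocirc'[of C] g(4) h(4) by blast
  qed
  moreover have "locally path_connected (- {c})"
    using lpc by (rule locally_open_subset) auto
  ultimately show thesis using that ne path_component_eq_connected_component by metis
qed

text \<open>The component of \<open>q\<close> in the complement of a separating point has at most that point as its
frontier, because all components of the complement are open.\<close>

lemma separating_open_set:
  fixes q z :: "'a::metric_space"
  assumes lpc: "locally path_connected (UNIV :: 'a set)" and conn: "connected (UNIV :: 'a set)"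
    and nocirc: "\<nexists>C :: 'a set. C homeomorphic sphere (0::complex) 1" and "q \<noteq> z"
  obtains U where "open U" "q \<in> U" "z \<notin> closure U" "finite (frontier U)"
proof -
  obtain c where c: "c \<noteq> q" "c \<noteq> z" "\<not> connected_component (- {c}) q z"
    using exists_separating_point[OF assms] .
  have lc: "locally connected (UNIV :: 'a set)" using lpc by (rule locally_path_connected_imp_locally_connected)
  have op: "open (connected_component_set (- {c}) x)" for x
  proof (cases "x = c")
    case False
    then show ?thesis using lc unfolding locally_connected_open_connected_component
      by (auto dest!: spec[of _ "- {c}"])
  qed (simp add: connected_component_eq_empty[THEN iffD2])
  define U where "U = connected_component_set (- {c}) q"
  have "y \<notin> closure U" if "y \<noteq> c" "y \<notin> U" for y
  proof -
    let ?V = "connected_component_set (- {c}) y"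
    have "y \<in> ?V" using that by (auto simp: connected_component_refl)
    moreover have "?V \<inter> U = {}"
      using that(2) unfolding U_def by (blast intro: connected_component_sym connected_component_trans)
    ultimately show ?thesis using op[of y] by (metis Int_commute closure_iff_nhds_not_empty order_refl)
  qed note cl = this
  show thesis
  proof (rule that)
    show "open U" "q \<in> U" using op c by (auto simp: U_def connected_component_refl)
    show "z \<notin> closure U" using cl c by (auto simp: U_def)
    have "frontier U \<subseteq> {c}" using cl \<open>open U\<close> by (auto simp: frontier_def interior_open)
    then show "finite (frontier U)" by (rule finite_subset) simp
  qed
qed

text \<open>Finitely many of the sets from the previous lemma suffice to exclude the compact complement of
\<open>V\<close>, and the frontier of their intersection is contained in the union of their frontiers.\<close>

lemma finite_frontier_neighbourhood:
  fixes q :: "'a::metric_space"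
  assumes comp: "compact (UNIV :: 'a set)"
    and lpc: "locally path_connected (UNIV :: 'a set)" and conn: "connected (UNIV :: 'a set)"
    and nocirc: "\<nexists>C :: 'a set. C homeomorphic sphere (0::complex) 1" and V: "open V" "q \<in> V"
  obtains G where "open G" "q \<in> G" "closure G \<subseteq> V" "finite (frontier G)"
proof -
  have "\<forall>z\<in>-V. \<exists>U. open U \<and> q \<in> U \<and> z \<notin> closure U \<and> finite (frontier U)"
    by (metis separating_open_set[OF lpc conn nocirc] V(2) ComplD)
  then obtain U where U: "\<And>z. z \<in> - V \<Longrightarrow> open (U z) \<and> q \<in> U z \<and> z \<notin> closure (U z) \<and> finite (frontier (U z))"
    by metis
  have "compact (- V)" using comp V(1) by (metis Int_UNIV_left compact_Int_closed closed_Compl)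
  then obtain Z where Z: "Z \<subseteq> - V" "finite Z" "- V \<subseteq> (\<Union>z\<in>Z. - closure (U z))"
    by (rule compactE_image[of "- V" "- V" "\<lambda>z. - closure (U z)"]) (use U in auto)
  define G where "G = (\<Inter>z\<in>Z. U z)"
  have clG: "closure G \<subseteq> closure (U z)" if "z \<in> Z" for z
    using that by (intro closure_mono) (auto simp: G_def)
  show thesis
  proof (rule that)
    show "open G" using U Z(1,2) by (auto simp: G_def)
    show "q \<in> G" using U Z(1) by (auto simp: G_def)
    show "closure G \<subseteq> V" using clG Z(3) by blast
    have "frontier G \<subseteq> (\<Union>z\<in>Z. frontier (U z))"
    proof
      fix x assume "x \<in> frontier G"
      then have "x \<in> closure G" "x \<notin> G" using \<open>open G\<close> by (auto simp: frontier_def interior_open)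
      then obtain z where "z \<in> Z" "x \<notin> U z" by (auto simp: G_def)
      then show "x \<in> (\<Union>z\<in>Z. frontier (U z))"
        using clG \<open>x \<in> closure G\<close> U Z(1) by (auto simp: frontier_def interior_open subset_iff)
    qed
    then show "finite (frontier G)" using U Z by (meson finite_UN_I finite_subset subsetD)
  qed
qed

section \<open>Flattening a map near finitely many points\<close>

text \<open>Around each point \<open>a\<close> of \<open>F\<close> the map runs along a path from \<open>q\<close> to \<open>v a\<close>, with the distance to \<open>a\<close> as
parameter; the induction chooses the radii so small that the balls stay disjoint.\<close>

lemma interpolate_finite_set:
  fixes F :: "'a::metric_space set" and N :: "'b::topological_space set"
  assumes "finite F" and N: "path_connected N" "q \<in> N" and "v ` F \<subseteq> N" "0 < r"
  shows "\<exists>u. continuous_on UNIV u \<and> range u \<subseteq> N \<and> (\<forall>a\<in>F. u a = v a) \<and>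
           (\<forall>x. (\<forall>a\<in>F. r \<le> dist x a) \<longrightarrow> u x = q)"
  using \<open>finite F\<close> \<open>v ` F \<subseteq> N\<close> \<open>0 < r\<close>
proof (induction F arbitrary: r rule: finite_induct)
  case empty
  then show ?case using N(2) by (intro exI[of _ "\<lambda>_. q"]) auto
next
  case (insert a F)
  obtain d where d: "0 < d" "\<And>b. b \<in> F \<Longrightarrow> d \<le> dist a b"
    using finite_set_avoid[OF insert.hyps(1), of a] insert.hyps(2) by metis
  define s where "s = min r (d / 2)"
  have s: "0 < s" "s \<le> r" "2 * s \<le> d" using d(1) insert.prems by (auto simp: s_def)
  obtain u where u: "continuous_on UNIV u" "range u \<subseteq> N" "\<forall>b\<in>F. u b = v b"
    "\<And>x. (\<forall>b\<in>F. s \<le> dist x b) \<Longrightarrow> u x = q"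
    using insert.IH[of s] insert.prems s(1) by auto
  obtain \<gamma> where \<gamma>: "path \<gamma>" "path_image \<gamma> \<subseteq> N" "pathstart \<gamma> = q" "pathfinish \<gamma> = v a"
    using N insert.prems(1) unfolding path_connected_def by (metis image_insert insert_subset)
  define u' where "u' x = (if dist x a \<le> s then \<gamma> (1 - dist x a / s) else u x)" for x
  have far: "s \<le> dist x b" if "dist x a \<le> s" "b \<in> F" for x b
    using d(2)[OF that(2)] that(1) s(3) dist_triangle[of a b x] dist_commute[of a x] by linarith
  have in01: "1 - dist x a / s \<in> {0..1}" if "dist x a \<le> s" for x
    using that s(1) by (auto simp: field_simps)
  have "continuous_on ({x. dist x a \<le> s} \<union> {x. s \<le> dist x a}) u'"
    unfolding u'_def
  proof (rule continuous_on_cases)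
    show "closed {x. dist x a \<le> s}" "closed {x. s \<le> dist x a}"
      by (intro closed_Collect_le continuous_intros)+
    show "continuous_on {x. dist x a \<le> s} (\<lambda>x. \<gamma> (1 - dist x a / s))"
    proof (rule continuous_on_compose2[of "{0..1}" \<gamma>])
      show "continuous_on {0..1} \<gamma>" using \<gamma>(1) by (simp add: path_def)
      show "continuous_on {x. dist x a \<le> s} (\<lambda>x. 1 - dist x a / s)"
        using s(1) by (intro continuous_intros) simp
      show "(\<lambda>x. 1 - dist x a / s) ` {x. dist x a \<le> s} \<subseteq> {0..1}" using in01 by blast
    qed
    show "continuous_on {x. s \<le> dist x a} u" using u(1) by (rule continuous_on_subset) simp
    have "\<gamma> (1 - dist x a / s) = u x" if "dist x a = s" for x
    proof -
      have "u x = q" using far that by (intro u(4)) simp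
      then show ?thesis using that \<gamma>(3) s(1) by (simp add: pathstart_def)
    qed
    then show "\<forall>x. x \<in> {x. dist x a \<le> s} \<and> \<not> dist x a \<le> s \<or> x \<in> {x. s \<le> dist x a} \<and> dist x a \<le> s \<longrightarrow>
        \<gamma> (1 - dist x a / s) = u x" by auto
  qed
  moreover have "{x. dist x a \<le> s} \<union> {x. s \<le> dist x a} = UNIV" by auto
  ultimately have "continuous_on UNIV u'" by simp
  moreover have "range u' \<subseteq> N"
  proof
    fix y assume "y \<in> range u'"
    then obtain x where y: "y = u' x" by blast
    show "y \<in> N"
    proof (cases "dist x a \<le> s")
      case True
      then have "y \<in> path_image \<gamma>" using in01[OF True] y by (simp add: u'_def path_image_def)
      then show ?thesis using \<gamma>(2) by blast
    next
      case False
      then show ?thesis using u(2) y by (simp add: u'_def image_subset_iff)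
    qed
  qed
  moreover have "u' a = v a" using s(1) \<gamma>(4) by (simp add: u'_def pathfinish_def)
  moreover have "u' b = v b" if "b \<in> F" for b
    using u(3) that d(2)[OF that] s dist_commute[of a b] by (simp add: u'_def)
  moreover have "u' x = q" if "\<forall>b\<in>insert a F. r \<le> dist x b" for x
  proof -
    have "u x = q" using that s(2) by (intro u(4)) force
    moreover have "u' x = \<gamma> 0" if "dist x a \<le> s"
    proof -
      have "dist x a = s" using that s(2) \<open>\<forall>b\<in>insert a F. r \<le> dist x b\<close> by force
      then show ?thesis using s(1) by (simp add: u'_def)
    qed
    ultimately show ?thesis using \<gamma>(3) by (auto simp: u'_def pathstart_def)
  qed
  ultimately show ?case by (intro exI[of _ u']) auto
qed

text \<open>With a finite frontier, extending \<open>f\<close> from the frontier into \<open>G\<close> only means interpolating finitely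
many values, and for this path connectedness of \<open>N\<close> is enough.\<close>

lemma flatten_near_point:
  fixes f :: "'a::metric_space \<Rightarrow> 'b::topological_space"
  assumes f: "continuous_on UNIV f" and G: "open G" "p \<in> G" "finite (frontier G)"
    and N: "f ` closure G \<subseteq> N" "path_connected N" "q \<in> N"
  obtains g r where "continuous_on UNIV g" "\<And>x. x \<notin> G \<Longrightarrow> g x = f x" "g ` G \<subseteq> N"
    "0 < r" "\<And>x. dist x p \<le> r \<Longrightarrow> g x = q"
proof -
  obtain e where e: "0 < e" "ball p e \<subseteq> G" using openE[OF G(1,2)] .
  have "f ` frontier G \<subseteq> N" using N(1) by (auto simp: frontier_def)
  from interpolate_finite_set[OF G(3) N(2,3) this half_gt_zero[OF e(1)]]
  obtain u where u: "continuous_on UNIV u" "range u \<subseteq> N" "\<forall>a\<in>frontier G. u a = f a"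
    "\<And>x. (\<forall>a\<in>frontier G. e / 2 \<le> dist x a) \<Longrightarrow> u x = q" by blast
  define g where "g x = (if x \<in> G then u x else f x)" for x
  have "continuous_on (closure G \<union> - G) g"
    unfolding g_def
  proof (rule continuous_on_cases)
    show "\<forall>x. x \<in> closure G \<and> x \<notin> G \<or> x \<in> - G \<and> x \<in> G \<longrightarrow> u x = f x"
      using u(3) G(1) by (auto simp: frontier_def interior_open)
    show "continuous_on (closure G) u" "continuous_on (- G) f"
      by (rule continuous_on_subset[OF u(1)], simp) (rule continuous_on_subset[OF f], simp)
  qed (use G(1) in auto)
  moreover have "closure G \<union> - G = UNIV" using closure_subset by auto
  ultimately have "continuous_on UNIV g" by simp
  moreover have "g x = q" if "dist x p \<le> e / 3" for x
  proof -
    have "x \<in> ball p e" using that e(1) dist_commute[of p x] by simp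
    then have "x \<in> G" using e(2) by blast
    moreover have "u x = q"
    proof (intro u(4) ballI)
      fix a assume "a \<in> frontier G"
      then have "a \<notin> ball p e" using e(2) G(1) by (auto simp: frontier_def interior_open)
      then show "e / 2 \<le> dist x a"
        using that e(1) dist_triangle[of p a x] dist_commute[of p x] unfolding mem_ball by linarith
    qed
    ultimately show ?thesis by (simp add: g_def)
  qed
  ultimately show thesis
    using e(1) u(2) by (intro that[of g "e / 3"]) (simp_all add: g_def image_subset_iff)
qed

lemma finite_set_disjoint_balls:
  fixes A :: "'a::metric_space set"
  assumes "finite A"
  obtains d where "\<And>p. 0 < d p" "\<And>p p'. \<lbrakk>p \<in> A; p' \<in> A; p \<noteq> p'\<rbrakk> \<Longrightarrow> ball p (d p) \<inter> ball p' (d p') = {}"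
proof -
  obtain d where d: "\<And>p. 0 < d p" "\<And>p x. \<lbrakk>x \<in> A; x \<noteq> p\<rbrakk> \<Longrightarrow> d p \<le> dist p x"
    using finite_set_avoid[OF assms] by metis
  have "ball p (d p / 2) \<inter> ball p' (d p' / 2) = {}" if "p \<in> A" "p' \<in> A" "p \<noteq> p'" for p p'
  proof -
    have "d p / 2 + d p' / 2 \<le> dist p p'"
      using d(2)[of p' p] d(2)[of p p'] that dist_commute[of p p'] by auto
    then show ?thesis by (rule disjoint_ballI)
  qed
  then show thesis using d(1) by (intro that[of "\<lambda>p. d p / 2"]) auto
qed

text \<open>The map is redefined on disjoint neighbourhoods of the points of \<open>A\<close>, one after the other. A changed
value stays in the same set \<open>N p\<close> as the original one, which controls the distance to \<open>f\<close>.\<close>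

lemma flatten_near_finite_set:
  fixes f :: "'a::metric_space \<Rightarrow> 'b::topological_space"
  assumes f: "continuous_on UNIV f" and "finite A"
    and basis: "\<And>V q. \<lbrakk>open V; q \<in> V\<rbrakk> \<Longrightarrow> \<exists>G. open G \<and> (q::'a) \<in> G \<and> closure G \<subseteq> V \<and> finite (frontier G)"
    and N: "\<And>p. p \<in> A \<Longrightarrow> open (N p) \<and> path_connected (N p) \<and> f p \<in> N p \<and> c p \<in> N p"
  obtains g \<rho> where "continuous_on UNIV g" "\<And>x. g x = f x \<or> (\<exists>p\<in>A. f x \<in> N p \<and> g x \<in> N p)"
    "0 < \<rho>" "\<And>p x. \<lbrakk>p \<in> A; dist x p \<le> \<rho>\<rbrakk> \<Longrightarrow> g x = c p"
proof -
  obtain d where d: "\<And>p. 0 < d p" "\<And>p p'. \<lbrakk>p \<in> A; p' \<in> A; p \<noteq> p'\<rbrakk> \<Longrightarrow> ball p (d p) \<inter> ball p' (d p') = {}"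
    using finite_set_disjoint_balls[OF \<open>finite A\<close>] by blast
  have "\<exists>G. open G \<and> p \<in> G \<and> closure G \<subseteq> ball p (d p) \<inter> f -` N p \<and> finite (frontier G)" if "p \<in> A" for p
    using N[OF that] d(1)[of p] open_vimage[OF _ f] by (intro basis) auto
  then obtain G where G: "\<And>p. p \<in> A \<Longrightarrow> open (G p)" "\<And>p. p \<in> A \<Longrightarrow> p \<in> G p" "\<And>p. p \<in> A \<Longrightarrow> finite (frontier (G p))"
    "\<And>p. p \<in> A \<Longrightarrow> closure (G p) \<subseteq> ball p (d p)" "\<And>p. p \<in> A \<Longrightarrow> f ` closure (G p) \<subseteq> N p"
    by (metis Int_subset_iff image_subset_iff_subset_vimage)
  have sub: "G p \<subseteq> ball p (d p)" "f ` G p \<subseteq> N p" if "p \<in> A" for p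
    using G(4,5)[OF that] closure_subset[of "G p"] by auto
  have "\<exists>g. continuous_on UNIV g \<and> (\<forall>x. x \<notin> (\<Union>p\<in>B. G p) \<longrightarrow> g x = f x) \<and>
      (\<forall>p\<in>B. g ` G p \<subseteq> N p \<and> (\<exists>r>0. \<forall>x. dist x p \<le> r \<longrightarrow> g x = c p))" if "B \<subseteq> A" for B
    using finite_subset[OF that \<open>finite A\<close>] that
  proof (induction B rule: finite_induct)
    case empty
    then show ?case using f by auto
  next
    case (insert p B)
    have p: "p \<in> A" "B \<subseteq> A" "p \<notin> B" using insert.hyps insert.prems by auto
    obtain g where "continuous_on UNIV g" "\<forall>x. x \<notin> (\<Union>p\<in>B. G p) \<longrightarrow> g x = f x"
      "\<forall>p\<in>B. g ` G p \<subseteq> N p \<and> (\<exists>r>0. \<forall>x. dist x p \<le> r \<longrightarrow> g x = c p)"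
      using insert.IH[OF p(2)] by (elim exE conjE)
    then have g: "continuous_on UNIV g" "\<And>x. x \<notin> (\<Union>p\<in>B. G p) \<Longrightarrow> g x = f x"
      "\<And>p. p \<in> B \<Longrightarrow> g ` G p \<subseteq> N p" "\<And>p. p \<in> B \<Longrightarrow> \<exists>r>0. \<forall>x. dist x p \<le> r \<longrightarrow> g x = c p"
      by simp_all
    have disj: "closure (G p) \<inter> G p' = {}" if "p' \<in> B" for p'
      using d(2)[of p p'] G(4)[of p] sub(1)[of p'] that p by blast
    then have "g x = f x" if "x \<in> closure (G p)" for x
      using that by (intro g(2)) blast
    then have "g ` closure (G p) \<subseteq> N p" using G(5)[OF p(1)] by auto
    then obtain g' r where g': "continuous_on UNIV g'" "\<And>x. x \<notin> G p \<Longrightarrow> g' x = g x" "g' ` G p \<subseteq> N p"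
      "0 < r" "\<And>x. dist x p \<le> r \<Longrightarrow> g' x = c p"
      using flatten_near_point[OF g(1) G(1-3)[OF p(1)], of "N p" "c p"] N[OF p(1)] by blast
    have same: "g' x = g x" if "x \<in> G p'" "p' \<in> B" for x p'
      using disj[OF that(2)] that(1) closure_subset[of "G p"] by (intro g'(2)) blast
    have "g' ` G p' \<subseteq> N p'" "\<exists>r>0. \<forall>x. dist x p' \<le> r \<longrightarrow> g' x = c p'" if p': "p' \<in> B" for p'
    proof -
      show "g' ` G p' \<subseteq> N p'" using same[OF _ p'] g(3)[OF p'] by auto
      obtain s where s: "0 < s" "\<forall>x. dist x p' \<le> s \<longrightarrow> g x = c p'" using g(4)[OF p'] by blast
      obtain e where e: "0 < e" "cball p' e \<subseteq> G p'"
        using G(1,2)[of p'] p' p(2) open_contains_cball by blast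
      have "g' x = c p'" if "dist x p' \<le> min s e" for x
        using same[of x p'] p' that e(2) s(2) by (auto simp: dist_commute)
      then show "\<exists>r>0. \<forall>x. dist x p' \<le> r \<longrightarrow> g' x = c p'" using s(1) e(1) by (intro exI[of _ "min s e"]) auto
    qed
    moreover have "g' x = f x" if "x \<notin> (\<Union>p\<in>insert p B. G p)" for x
      using that g(2)[of x] g'(2)[of x] by auto
    moreover have "\<exists>r>0. \<forall>x. dist x p \<le> r \<longrightarrow> g' x = c p" using g'(4,5) by blast
    ultimately show ?case using g'(1,3) by (intro exI[of _ g']) simp
  qed
  from this[OF subset_refl]
  obtain g where "continuous_on UNIV g" "\<forall>x. x \<notin> (\<Union>p\<in>A. G p) \<longrightarrow> g x = f x"
      "\<forall>p\<in>A. g ` G p \<subseteq> N p \<and> (\<exists>r>0. \<forall>x. dist x p \<le> r \<longrightarrow> g x = c p)"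
    by (elim exE conjE)
  then have g: "continuous_on UNIV g" "\<And>x. x \<notin> (\<Union>p\<in>A. G p) \<Longrightarrow> g x = f x"
      "\<And>p. p \<in> A \<Longrightarrow> g ` G p \<subseteq> N p" "\<And>p. p \<in> A \<Longrightarrow> \<exists>r>0. \<forall>x. dist x p \<le> r \<longrightarrow> g x = c p"
    by simp_all
  then obtain r where r: "\<And>p. p \<in> A \<Longrightarrow> 0 < r p" "\<And>p x. \<lbrakk>p \<in> A; dist x p \<le> r p\<rbrakk> \<Longrightarrow> g x = c p"
    by metis
  define \<rho> where "\<rho> = Min (insert 1 (r ` A))"
  have \<rho>: "0 < \<rho>" "\<And>p. p \<in> A \<Longrightarrow> \<rho> \<le> r p"
    using r(1) \<open>finite A\<close> by (auto simp: \<rho>_def)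
  show thesis
  proof (rule that[OF g(1) _ \<rho>(1)])
    show "g x = f x \<or> (\<exists>p\<in>A. f x \<in> N p \<and> g x \<in> N p)" for x
      using g(2)[of x] g(3) sub(2) by blast
    show "g x = c p" if "p \<in> A" "dist x p \<le> \<rho>" for p x
      using r(2)[OF that(1), of x] \<rho>(2)[OF that(1)] that(2) by simp
  qed
qed

text \<open>A finite cover by small path connected sets \<open>N x\<close> provides both the \<open>\<epsilon>\<close>-dense set and the new values:
its centres form \<open>P\<close>, and the value near \<open>p\<close> is moved to the centre of a set of the cover that
contains \<open>f p\<close>. Hence the approximating map sends \<open>P\<close> into itself.\<close>

lemma approximate_by_locally_constant_at_finite_set:
  fixes f :: "'a::metric_space \<Rightarrow> 'a"
  assumes comp: "compact (UNIV :: 'a set)" and lpc: "locally path_connected (UNIV :: 'a set)"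
    and basis: "\<And>V q. \<lbrakk>open V; q \<in> V\<rbrakk> \<Longrightarrow> \<exists>G. open G \<and> (q::'a) \<in> G \<and> closure G \<subseteq> V \<and> finite (frontier G)"
    and f: "continuous_on UNIV f" and "0 < \<epsilon>"
  obtains g P \<rho> where "continuous_on UNIV g" "\<And>x. dist (f x) (g x) < \<epsilon>" 
    "\<And>x. \<exists>p\<in>P. dist x p < \<epsilon>" "0 < \<rho>" "\<And>p. p \<in> P \<Longrightarrow> \<exists>q\<in>P. \<forall>x. dist x p \<le> \<rho> \<longrightarrow> g x = q"
proof -
  have "\<exists>N. open N \<and> path_connected N \<and> x \<in> N \<and> N \<subseteq> ball x (\<epsilon>/2)" for x :: 'a
    using lpc[unfolded locally_path_connected, rule_format, of "ball x (\<epsilon>/2)" x] \<open>0 < \<epsilon>\<close> by auto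
  then obtain N where N: "\<And>x::'a. open (N x)" "\<And>x. path_connected (N x)" "\<And>x. x \<in> N x" "\<And>x. N x \<subseteq> ball x (\<epsilon>/2)"
    by metis
  obtain P where P: "finite P" "UNIV \<subseteq> (\<Union>x\<in>P. N x)"
    by (rule compactE_image[OF comp, of UNIV N]) (use N in auto)
  then have "\<forall>p. \<exists>q. q \<in> P \<and> f p \<in> N q" by blast
  then obtain c where c: "\<And>p. c p \<in> P" "\<And>p. f p \<in> N (c p)" by metis
  obtain g \<rho> where g: "continuous_on UNIV g" "\<And>x. g x = f x \<or> (\<exists>p\<in>P. f x \<in> N (c p) \<and> g x \<in> N (c p))"
    "0 < \<rho>" "\<And>p x. \<lbrakk>p \<in> P; dist x p \<le> \<rho>\<rbrakk> \<Longrightarrow> g x = c p"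
    by (rule flatten_near_finite_set[OF f P(1) basis, of "\<lambda>p. N (c p)" c]) (use N c in auto)
  show thesis
  proof (rule that[OF g(1) _ _ g(3)])
    show "dist (f x) (g x) < \<epsilon>" for x
      using g(2)[of x]
    proof
      assume "\<exists>p\<in>P. f x \<in> N (c p) \<and> g x \<in> N (c p)"
      then obtain p where "f x \<in> ball (c p) (\<epsilon>/2)" "g x \<in> ball (c p) (\<epsilon>/2)" using N(4) by blast
      then show ?thesis using dist_triangle_half_r[of "c p" "f x" \<epsilon> "g x"] by simp
    qed (use \<open>0 < \<epsilon>\<close> in simp)
    show "\<exists>p\<in>P. dist x p < \<epsilon>" for x
    proof -
      obtain p where "p \<in> P" "x \<in> ball p (\<epsilon>/2)" using P(2) N(4) by blast
      then show ?thesis using \<open>0 < \<epsilon>\<close> dist_commute[of p x] by (intro bexI[of _ p]) auto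
    qed
    show "\<exists>q\<in>P. \<forall>x. dist x p \<le> \<rho> \<longrightarrow> g x = q" if "p \<in> P" for p
      using g(4)[OF that] c(1)[of p] by blast
  qed
qed

section \<open>Pseudo orbits and stable points\<close>

text \<open>An open version of chain continuity with precision \<open>\<epsilon>\<close>: two pseudo orbits that start near \<open>p\<close> are
compared with each other, which makes the set open, whereas the comparison with the true orbit of
\<open>p\<close> refers to the single point \<open>p\<close>.\<close>

definition stable_points :: "('a::metric_space \<Rightarrow> 'a) \<Rightarrow> real \<Rightarrow> 'a set" where
  "stable_points f \<epsilon> = {p. \<exists>\<delta>>0. \<exists>r>0. \<forall>x y. pseudo_orbit f \<delta> x \<and> pseudo_orbit f \<delta> y \<and>
     dist p (x 0) < r \<and> dist p (y 0) < r \<longrightarrow> (\<forall>i. dist (x i) (y i) \<le> \<epsilon>)}"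

lemma stable_points_mono: "\<epsilon> \<le> \<epsilon>' \<Longrightarrow> stable_points f \<epsilon> \<subseteq> stable_points f \<epsilon>'"
  unfolding stable_points_def by (blast intro: order_trans)

lemma pseudo_orbit_funpow: "0 \<le> \<delta> \<Longrightarrow> pseudo_orbit f \<delta> (\<lambda>i. (f ^^ i) p)"
  by (simp add: pseudo_orbit_def)

lemma open_stable_points: "open (stable_points f \<epsilon>)"
  unfolding open_contains_ball
proof
  fix p assume "p \<in> stable_points f \<epsilon>"
  then obtain \<delta> r where dr: "0 < \<delta>" "0 < r" "\<And>x y i. \<lbrakk>pseudo_orbit f \<delta> x; pseudo_orbit f \<delta> y;
     dist p (x 0) < r; dist p (y 0) < r\<rbrakk> \<Longrightarrow> dist (x i) (y i) \<le> \<epsilon>"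
    unfolding stable_points_def by blast
  have "ball p (r/2) \<subseteq> stable_points f \<epsilon>"
  proof
    fix q assume q: "q \<in> ball p (r/2)"
    have "dist p z < r" if "dist q z < r/2" for z
      using that q dist_triangle[of p z q] by simp
    then have "\<forall>x y. pseudo_orbit f \<delta> x \<and> pseudo_orbit f \<delta> y \<and>
       dist q (x 0) < r/2 \<and> dist q (y 0) < r/2 \<longrightarrow> (\<forall>i. dist (x i) (y i) \<le> \<epsilon>)"
      using dr(3) by blast
    then show "q \<in> stable_points f \<epsilon>"
      unfolding stable_points_def using dr(1) half_gt_zero[OF dr(2)] by blast
  qed
  then show "\<exists>e>0. ball p e \<subseteq> stable_points f \<epsilon>" using dr(2) by (intro exI[of _ "r/2"]) auto
qed

text \<open>If \<open>f\<close> is chain continuous at \<open>p\<close>, then a pseudo orbit that starts near \<open>p\<close> becomes one that starts at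
\<open>p\<close> after its first point is exchanged, by continuity of \<open>f\<close> at \<open>p\<close>. Conversely, the true orbit is
itself a pseudo orbit.\<close>

lemma CC_eq_Inter_stable_points:
  fixes f :: "'a::metric_space \<Rightarrow> 'a"
  assumes f: "continuous_on UNIV f"
  shows "CC f = (\<Inter>n. stable_points f (inverse (real (Suc n))))"
proof (intro set_eqI iffI)
  fix p assume "p \<in> CC f"
  then have cc: "\<And>\<epsilon>. 0 < \<epsilon> \<Longrightarrow> \<exists>\<delta>>0. \<forall>x. pseudo_orbit f \<delta> x \<and> x 0 = p \<longrightarrow> shadowed_by f \<epsilon> x p"
    by (auto simp: CC_def chain_continuous_at_def)
  have "p \<in> stable_points f \<epsilon>" if "0 < \<epsilon>" for \<epsilon>
  proof -
    obtain \<delta> where \<delta>: "0 < \<delta>" "\<And>x. pseudo_orbit f \<delta> x \<Longrightarrow> x 0 = p \<Longrightarrow> shadowed_by f (\<epsilon>/2) x p"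
      using cc[of "\<epsilon>/2"] \<open>0 < \<epsilon>\<close> by auto
    obtain s where s: "0 < s" "\<And>y. dist y p < s \<Longrightarrow> dist (f y) (f p) < \<delta>/2"
      using f[unfolded continuous_on_iff, rule_format, of p "\<delta>/2"] \<delta>(1) by auto
    define r where "r = min s (\<epsilon>/2)"
    have near: "dist ((f ^^ i) p) (x i) \<le> \<epsilon>/2" if x: "pseudo_orbit f (\<delta>/2) x" "dist p (x 0) < r" for x i
    proof (cases i)
      case 0
      then show ?thesis using x(2) by (simp add: r_def)
    next
      case (Suc j)
      let ?x = "x(0 := p)"
      have "dist (f (?x k)) (?x (Suc k)) \<le> \<delta>" for k
      proof (cases k)
        case 0
        have "dist (f p) (f (x 0)) < \<delta>/2"
          using s(2)[of "x 0"] x(2) by (simp add: r_def dist_commute)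
        moreover have "dist (f (x 0)) (x (Suc 0)) \<le> \<delta>/2" using x(1) by (simp add: pseudo_orbit_def)
        ultimately show ?thesis using 0 dist_triangle[of "f p" "x (Suc 0)" "f (x 0)"] by simp
      next
        case (Suc m)
        then have "dist (f (x k)) (x (Suc k)) \<le> \<delta>/2" using x(1) by (simp add: pseudo_orbit_def)
        then show ?thesis using Suc \<delta>(1) by simp
      qed
      then have "shadowed_by f (\<epsilon>/2) ?x p" by (intro \<delta>(2)) (auto simp: pseudo_orbit_def)
      then show ?thesis using Suc unfolding shadowed_by_def by (metis fun_upd_other nat.discI)
    qed
    have "\<forall>x y. pseudo_orbit f (\<delta>/2) x \<and> pseudo_orbit f (\<delta>/2) y \<and> dist p (x 0) < r \<and> dist p (y 0) < r \<longrightarrow>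
        (\<forall>i. dist (x i) (y i) \<le> \<epsilon>)"
    proof (intro allI impI, elim conjE)
      fix x y i assume "pseudo_orbit f (\<delta>/2) x" "pseudo_orbit f (\<delta>/2) y" "dist p (x 0) < r" "dist p (y 0) < r"
      then have "dist ((f ^^ i) p) (x i) \<le> \<epsilon>/2" "dist ((f ^^ i) p) (y i) \<le> \<epsilon>/2" using near by blast+
      then show "dist (x i) (y i) \<le> \<epsilon>" using dist_triangle3[of "x i" "y i" "(f ^^ i) p"] by linarith
    qed
    moreover have "0 < r" using s(1) \<open>0 < \<epsilon>\<close> by (simp add: r_def)
    ultimately show ?thesis unfolding stable_points_def using half_gt_zero[OF \<delta>(1)] by blast
  qed
  then show "p \<in> (\<Inter>n. stable_points f (inverse (real (Suc n))))" by simp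
next
  fix p assume p: "p \<in> (\<Inter>n. stable_points f (inverse (real (Suc n))))"
  have "\<exists>\<delta>>0. \<forall>x. pseudo_orbit f \<delta> x \<and> x 0 = p \<longrightarrow> shadowed_by f \<epsilon> x p" if \<epsilon>: "0 < \<epsilon>" for \<epsilon>
  proof -
    obtain n where "inverse (real (Suc n)) < \<epsilon>" using reals_Archimedean[OF \<epsilon>] by blast
    then have "p \<in> stable_points f \<epsilon>" using p stable_points_mono[of "inverse (real (Suc n))" \<epsilon> f] by auto
    then obtain \<delta> r where dr: "0 < \<delta>" "0 < r" "\<And>x y i. \<lbrakk>pseudo_orbit f \<delta> x; pseudo_orbit f \<delta> y;
       dist p (x 0) < r; dist p (y 0) < r\<rbrakk> \<Longrightarrow> dist (x i) (y i) \<le> \<epsilon>"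
      unfolding stable_points_def by blast
    have "shadowed_by f \<epsilon> x p" if "pseudo_orbit f \<delta> x" "x 0 = p" for x
      unfolding shadowed_by_def
    proof
      fix i show "dist ((f ^^ i) p) (x i) \<le> \<epsilon>"
        using dr(3)[OF pseudo_orbit_funpow that(1), of p i] that(2) dr(1,2) by simp
    qed
    then show ?thesis using dr(1) by blast
  qed
  then show "p \<in> CC f" by (simp add: CC_def chain_continuous_at_def)
qed

text \<open>The \<open>\<rho>\<close>-ball around a point of \<open>P\<close> is a trap: \<open>g\<close> maps it to a single point of \<open>P\<close>, so that a small
error leads into the \<open>\<rho>\<close>-ball around that point. All pseudo orbits from the ball therefore follow the
same sequence of balls. The argument tolerates a perturbation \<open>h\<close> of \<open>g\<close>.\<close>

lemma trap_stable_points: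
  fixes g h :: "'a::metric_space \<Rightarrow> 'a"
  assumes g: "\<And>p. p \<in> P \<Longrightarrow> \<exists>q\<in>P. \<forall>x. dist x p \<le> \<rho> \<longrightarrow> g x = q" and "0 < \<rho>"
    and h: "\<And>x. dist (h x) (g x) \<le> \<rho> / 2"
  shows "P \<subseteq> stable_points h (2 * \<rho>)"
proof
  fix p assume "p \<in> P"
  obtain \<pi> where \<pi>: "\<And>p. p \<in> P \<Longrightarrow> \<pi> p \<in> P" "\<And>p x. \<lbrakk>p \<in> P; dist x p \<le> \<rho>\<rbrakk> \<Longrightarrow> g x = \<pi> p"
    using g by metis
  have track: "(\<pi> ^^ i) p \<in> P \<and> dist (x i) ((\<pi> ^^ i) p) \<le> \<rho>"
    if x: "pseudo_orbit h (\<rho>/2) x" "dist p (x 0) < \<rho>" for x i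
  proof (induction i)
    case 0
    then show ?case using \<open>p \<in> P\<close> x(2) by (simp add: dist_commute)
  next
    case (Suc i)
    have "dist (h (x i)) (x (Suc i)) \<le> \<rho>/2" using x(1) by (simp add: pseudo_orbit_def)
    moreover have "dist (h (x i)) ((\<pi> ^^ Suc i) p) \<le> \<rho>/2" using h[of "x i"] \<pi>(2)[of "(\<pi> ^^ i) p" "x i"] Suc by simp
    ultimately have "dist (x (Suc i)) ((\<pi> ^^ Suc i) p) \<le> \<rho>"
      using dist_triangle3[of "x (Suc i)" "(\<pi> ^^ Suc i) p" "h (x i)"] by linarith
    then show ?case using \<pi>(1) Suc by simp
  qed
  have "\<forall>x y. pseudo_orbit h (\<rho>/2) x \<and> pseudo_orbit h (\<rho>/2) y \<and> dist p (x 0) < \<rho> \<and> dist p (y 0) < \<rho> \<longrightarrow>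
      (\<forall>i. dist (x i) (y i) \<le> 2 * \<rho>)"
  proof (intro allI impI, elim conjE)
    fix x y i assume "pseudo_orbit h (\<rho>/2) x" "pseudo_orbit h (\<rho>/2) y" "dist p (x 0) < \<rho>" "dist p (y 0) < \<rho>"
    then have "dist (x i) ((\<pi> ^^ i) p) \<le> \<rho>" "dist (y i) ((\<pi> ^^ i) p) \<le> \<rho>" using track by blast+
    then show "dist (x i) (y i) \<le> 2 * \<rho>" using dist_triangle2[of "x i" "y i" "(\<pi> ^^ i) p"] by linarith
  qed
  then show "p \<in> stable_points h (2 * \<rho>)"
    unfolding stable_points_def using half_gt_zero[OF \<open>0 < \<rho>\<close>] \<open>0 < \<rho>\<close> by blast
qed

text \<open>The sets of stable points decrease with the precision, so that density up to \<open>1 / (n+1)\<close> for all \<open>n\<close>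
makes each of them dense; their intersection is then dense by Baire's theorem.\<close>

lemma almost_chain_continuousI:
  fixes f :: "'a::metric_space \<Rightarrow> 'a"
  assumes comp: "compact (UNIV :: 'a set)" and f: "continuous_on UNIV f"
    and dense: "\<And>n x. \<exists>p\<in>stable_points f (inverse (real (Suc n))). dist x p < inverse (real (Suc n))"
  shows "almost_chain_continuous f"
proof -
  let ?S = "\<lambda>n. stable_points f (inverse (real (Suc n)))"
  have cl: "closure (?S n) = UNIV" for n
  proof -
    have "x \<in> closure (?S n)" for x
      unfolding closure_approachable
    proof (intro allI impI)
      fix e :: real assume "0 < e"
      then obtain m where m: "inverse (real (Suc m)) < e" using reals_Archimedean by blast
      have inv: "inverse (real (Suc (max m n))) \<le> inverse (real (Suc m))"
        "inverse (real (Suc (max m n))) \<le> inverse (real (Suc n))" by (auto intro!: le_imp_inverse_le)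
      obtain p where "p \<in> ?S (max m n)" "dist x p < inverse (real (Suc (max m n)))" using dense by blast
      moreover from this have "dist p x < e" using inv(1) m dist_commute[of p x] by linarith
      ultimately show "\<exists>p\<in>?S n. dist p x < e" using stable_points_mono[OF inv(2), of f] by blast
    qed
    then show ?thesis by auto
  qed
  have CC: "CC f = \<Inter>(range ?S)" by (simp add: CC_eq_Inter_stable_points[OF f])
  have "completely_metrizable_space (euclidean :: 'a topology) \<or>
      locally_compact_space (euclidean :: 'a topology) \<and> regular_space (euclidean :: 'a topology)"
    using comp by (auto intro!: compact_imp_locally_compact_space compact_Hausdorff_imp_regular_space
        simp: compact_space_def)
  then have "(euclidean closure_of \<Inter>(range ?S)) = topspace euclidean"
    by (rule Baire_category) (auto simp: open_stable_points cl simp del: of_nat_Suc)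
  moreover have "gdelta_in euclidean (\<Inter>(range ?S))"
    by (intro gdelta_in_Inter) (auto intro!: open_imp_gdelta_in simp: open_stable_points)
  ultimately show ?thesis by (simp add: almost_chain_continuous_def CC)
qed

section \<open>Generic maps of a dendrite\<close>

theorem mainTheorem4:
  assumes "dendrite (UNIV :: 'a::metric_space set)"
  shows "\<exists>U :: nat \<Rightarrow> ('a \<Rightarrow>\<^sub>C 'a) set.
           (\<forall>n. open (U n) \<and> closure (U n) = UNIV) \<and>
           (\<Inter>n. U n) \<subseteq> {f. almost_chain_continuous (apply_bcontfun f)}"
proof -
  have comp: "compact (UNIV :: 'a set)" and conn: "connected (UNIV :: 'a set)"
    and lc: "locally connected (UNIV :: 'a set)"
    and nocirc: "\<nexists>C :: 'a set. C homeomorphic sphere (0::complex) 1"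
    using assms by (auto simp: dendrite_def)
  have lpc: "locally path_connected (UNIV :: 'a set)"
    using lc compact_imp_complete[OF comp] by (rule complete_locally_connected_imp_locally_path_connected)
  have basis: "\<exists>G. open G \<and> q \<in> G \<and> closure G \<subseteq> V \<and> finite (frontier G)"
    if "open V" "q \<in> V" for V and q :: 'a
    by (rule finite_frontier_neighbourhood[OF comp lpc conn nocirc that]) blast
  define \<epsilon> where "\<epsilon> n = inverse (real (Suc n))" for n
  have \<epsilon>: "0 < \<epsilon> n" for n by (simp add: \<epsilon>_def)
  define A where "A n = {h :: 'a \<Rightarrow>\<^sub>C 'a. \<forall>x. \<exists>p\<in>stable_points h (\<epsilon> n). dist x p < \<epsilon> n}" for n
  have dense: "f \<in> closure (interior (A n))" for f n
    unfolding closure_approachable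
  proof (intro allI impI)
    fix e :: real assume "0 < e"
    define \<eta> where "\<eta> = min (e / 2) (\<epsilon> n)"
    have \<eta>: "0 < \<eta>" "\<eta> < e" "\<eta> \<le> \<epsilon> n" using \<open>0 < e\<close> \<epsilon>[of n] by (auto simp: \<eta>_def)
    have f: "continuous_on UNIV (apply_bcontfun f)" by simp
    obtain g' P \<rho>' where g': "continuous_on UNIV g'" "\<And>x. dist (f x) (g' x) < \<eta>"
      and P: "\<And>x. \<exists>p\<in>P. dist x p < \<eta>" and \<rho>': "0 < \<rho>'"
      "\<And>p. p \<in> P \<Longrightarrow> \<exists>q\<in>P. \<forall>x. dist x p \<le> \<rho>' \<longrightarrow> g' x = q"
    proof (rule approximate_by_locally_constant_at_finite_set[OF comp lpc basis f \<eta>(1)])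
      fix g' P \<rho>'
      assume "continuous_on UNIV g'" "\<And>x. dist (f x) (g' x) < \<eta>" "\<And>x. \<exists>p\<in>P. dist x p < \<eta>"
        "0 < \<rho>'" "\<And>p. p \<in> P \<Longrightarrow> \<exists>q\<in>P. \<forall>x. dist x p \<le> \<rho>' \<longrightarrow> g' x = q"
      then show thesis by (rule that)
    qed
    have "g' \<in> bcontfun" using g'(1) bcontfun_eq_continuous_if_compact[OF comp] by auto
    then obtain g :: "'a \<Rightarrow>\<^sub>C 'a" where g: "apply_bcontfun g = g'" using Bcontfun_inverse by blast
    define \<rho> where "\<rho> = min \<rho>' (\<epsilon> n / 2)"
    have \<rho>: "0 < \<rho>" "\<rho> \<le> \<rho>'" "2 * \<rho> \<le> \<epsilon> n" using \<rho>'(1) \<epsilon>[of n] by (auto simp: \<rho>_def)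
    have trap: "\<exists>q\<in>P. \<forall>x. dist x p \<le> \<rho> \<longrightarrow> g x = q" if "p \<in> P" for p
      using \<rho>'(2)[OF that] \<rho>(2) unfolding g by (meson order_trans)
    have "ball g (\<rho> / 2) \<subseteq> A n"
    proof
      fix h assume "h \<in> ball g (\<rho> / 2)"
      then have "dist h g < \<rho> / 2" by (simp add: dist_commute)
      then have "dist (h x) (g x) \<le> \<rho> / 2" for x
        using dist_fun_lt_imp_dist_val_lt less_imp_le by blast
      then have "P \<subseteq> stable_points h (2 * \<rho>)" using trap \<rho>(1) by (intro trap_stable_points) auto
      then have sub: "P \<subseteq> stable_points h (\<epsilon> n)" using stable_points_mono[OF \<rho>(3)] by blast
      have "\<exists>p\<in>stable_points h (\<epsilon> n). dist x p < \<epsilon> n" for x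
        using P[of x] sub \<eta>(3) by (meson less_le_trans subsetD)
      then show "h \<in> A n" by (simp add: A_def)
    qed
    then have "g \<in> interior (A n)"
      using \<rho>(1) by (intro interiorI[of "ball g (\<rho> / 2)"]) auto
    moreover have "dist f g \<le> \<eta>" using g'(2) by (intro dist_bound) (simp add: g less_imp_le)
    then have "dist g f < e" using \<eta>(2) dist_commute[of g f] by linarith
    ultimately show "\<exists>g\<in>interior (A n). dist g f < e" by blast
  qed
  have "almost_chain_continuous (apply_bcontfun f)" if "f \<in> (\<Inter>n. interior (A n))" for f
  proof (rule almost_chain_continuousI[OF comp])
    fix n x
    have "f \<in> A n" using that interior_subset by blast
    then show "\<exists>p\<in>stable_points f (inverse (real (Suc n))). dist x p < inverse (real (Suc n))"
      unfolding A_def \<epsilon>_def by blast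
  qed simp
  then show ?thesis
    using dense by (intro exI[of _ "\<lambda>n. interior (A n)"]) blast
qed

end
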